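(* Let $\alpha,\beta\in\mathbb{R}^2$. If $\alpha\succ\beta$, then $\mathcal{M}(D_\alpha)\subseteq\mathcal{M}(D_\beta)$.
   Context: $\mathbb{U}$ is the open unit disc in $\mathbb{C}$, $\mathbb{U}^2=\mathbb{U}\times\mathbb{U}$, and $\mathbb{Z}_+$ is the set of nonnegative integers. For $\alpha=(\alpha_1,\alpha_2)\in\mathbb{R}^2$, $D_\alpha$ is the space of functions $f(z,w)=\sum_{(k,l)\in\mathbb{Z}_+^2}a_{k,l}z^kw^l$ on $\mathbb{U}^2$ with $\sum_{(k,l)}|a_{k,l}|^2(k+1)^{\alpha_1}(l+1)^{\alpha_2}<\infty$. $\mathcal{M}(D_\alpha)$ is the set of functions $\phi:\mathbb{U}^2\to\mathbb{C}$ such that $\phi f\in D_\alpha$ for all $f\in D_\alpha$. $\alpha\succ\beta$ means $\alpha_1>\beta_1$ and $\alpha_2>\beta_2$. *)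

theory Defs
  imports "HOL-Analysis.Analysis"
begin

definition bidisc :: "(complex \<times> complex) set" where
  "bidisc = ball 0 1 \<times> ball 0 1"

(* Functions on the bidisc are represented by total functions on complex pairs; only their
   values on the bidisc matter for membership in the spaces below.
   Double series are unordered sums over all pairs of natural numbers. *)
definition D_space :: "real \<times> real \<Rightarrow> (complex \<times> complex \<Rightarrow> complex) set" where
  "D_space \<alpha> = {f. \<exists>a :: nat \<times> nat \<Rightarrow> complex.
      (\<lambda>(k, l). (cmod (a (k, l)))\<^sup>2 * (real k + 1) powr fst \<alpha> * (real l + 1) powr snd \<alpha>)
        summable_on UNIV \<and>
      (\<forall>(z, w) \<in> bidisc. ((\<lambda>(k, l). a (k, l) * z ^ k * w ^ l) has_sum f (z, w)) UNIV)}"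

definition multipliers :: "real \<times> real \<Rightarrow> (complex \<times> complex \<Rightarrow> complex) set" where
  "multipliers \<alpha> = {\<phi>. \<forall>f \<in> D_space \<alpha>. (\<lambda>p. \<phi> p * f p) \<in> D_space \<alpha>}"

definition dominates :: "real \<times> real \<Rightarrow> real \<times> real \<Rightarrow> bool" where
  "dominates \<alpha> \<beta> \<longleftrightarrow> fst \<alpha> > fst \<beta> \<and> snd \<alpha> > snd \<beta>"

end

theory Submission
  imports Defs
begin

text \<open>
  A function in the space of \<open>\<alpha>\<close> is a double sequence of coefficients that is square summable with weight
  \<open>(k + 1) powr \<alpha>\<^sub>1 * (l + 1) powr \<alpha>\<^sub>2\<close>, and a multiplier acts on coefficients by convolution with its own
  coefficients \<open>c\<close> (lemma \<open>multiplier_coeffs\<close>). The inclusion is thus a statement about one operator on two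
  weighted \<open>\<ell>\<^sup>2\<close> spaces. It is an interpolation argument: the operator is bounded for the weight of \<open>\<alpha>\<close> and
  for the indicator weight of every box, and the weight of \<open>\<beta>\<close> lies in between.

  Boundedness for the weight of \<open>\<alpha>\<close> is automatic (\<open>conv_uniformly_bounded\<close>): a triangular operator that maps the
  space to itself is bounded, by a gliding hump.

  The other endpoint needs no function theory. Multiplication by a high power of \<open>z w\<close> moves all
  coefficients far out, where the weight is almost constant, and commutes with the operator; in the limit the operator
  is bounded on unweighted \<open>\<ell>\<^sup>2\<close> with the same constant (\<open>bounded_conv_unweighted\<close>). Since the operator is
  lower triangular, truncating the unweighted norm to any box \<open>{..q}\<close> preserves the bound.

  For the interpolation, splitting the indices according to which weight is smaller gives boundedness for the
  minimum of \<open>\<alpha>\<close>'s weight and any constant, cut off to any box (\<open>bounded_conv_box_min\<close>). Positive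
  combinations of such weights are again admissible (\<open>bounded_conv_sum\<close>), and because both exponents strictly drop
  from \<open>\<alpha>\<close> to \<open>\<beta>\<close>, the weight of \<open>\<beta>\<close> is up to constants such a combination over dyadic boxes
  (\<open>conv_interpolation\<close>).
\<close>

section \<open>Triangular convolution operators on double sequences\<close>

lemma finite_pair_atMost [simp]: "finite {..(m::nat\<times>nat)}"
proof -
  have "{..m} \<subseteq> {..fst m} \<times> {..snd m}" by (auto simp: less_eq_prod_def)
  then show ?thesis by (rule finite_subset) simp
qed

lemma pair_add_diff [simp]:
  fixes m i k :: "nat \<times> nat"
  shows "m + i - i = m" "k + i - (m + i) = k - m" "m + i - m = i"
    "i \<le> m \<Longrightarrow> i + (m - i) = m" "i \<le> m \<Longrightarrow> m - i + i = m"
  by (auto simp: less_eq_prod_def prod_eq_iff)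

lemma pair_le_add [simp]:
  fixes m i k :: "nat \<times> nat"
  shows "i \<le> m + i" "i \<le> i + m" "m + i \<le> k + i \<longleftrightarrow> m \<le> k"
  by (auto simp: less_eq_prod_def)

text \<open>
  On the level of coefficients, multiplication by \<open>\<Sum> c\<^sub>m z\<^sup>m\<close> is this operator. Only indices
  \<open>i \<le> m\<close> in the product order of \<open>\<nat> \<times> \<nat>\<close> enter, so it is lower triangular: its output on a box
  \<open>{..n}\<close> depends only on the input on that box.
\<close>
definition conv :: "(nat \<times> nat \<Rightarrow> complex) \<Rightarrow> (nat \<times> nat \<Rightarrow> complex) \<Rightarrow> nat \<times> nat \<Rightarrow> complex" where
  "conv c f m = (\<Sum>i\<in>{..m}. c (m - i) * f i)"

text \<open>
  Cutting off at a box keeps every sum finite, so that arbitrary coefficient families can be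
  treated without convergence questions; the squared weighted norm is the supremum over \<open>n\<close>.
\<close>
definition energy :: "(nat \<times> nat \<Rightarrow> real) \<Rightarrow> (nat \<times> nat \<Rightarrow> complex) \<Rightarrow> nat \<times> nat \<Rightarrow> real" where
  "energy w f n = (\<Sum>m\<in>{..n}. (cmod (f m))\<^sup>2 * w m)"

text \<open>
  Because of triangularity, comparing input and output on the same box for all families is the
  same as boundedness, with squared norm at most \<open>K\<close>, on the weighted \<open>\<ell>\<^sup>2\<close> space of \<open>w\<close>.
\<close>
definition bounded_conv :: "(nat \<times> nat \<Rightarrow> real) \<Rightarrow> (nat \<times> nat \<Rightarrow> complex) \<Rightarrow> real \<Rightarrow> bool" where
  "bounded_conv w c K \<longleftrightarrow> (\<forall>f n. energy w (conv c f) n \<le> K * energy w f n)"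

lemma bounded_convD: "bounded_conv w c K \<Longrightarrow> energy w (conv c f) n \<le> K * energy w f n"
  unfolding bounded_conv_def by blast

lemma conv_cong:
  assumes "\<And>i. i \<le> m \<Longrightarrow> f i = g i"
  shows "conv c f m = conv c g m"
  unfolding conv_def by (rule sum.cong) (use assms in auto)

lemma energy_cong:
  assumes "\<And>m. m \<le> n \<Longrightarrow> f m = g m"
  shows "energy w f n = energy w g n"
  unfolding energy_def by (rule sum.cong) (use assms in auto)

lemma energy_conv_cong:
  assumes "\<And>m. m \<le> n \<Longrightarrow> f m = g m"
  shows "energy w (conv c f) n = energy w (conv c g) n"
  by (intro energy_cong conv_cong) (use assms in \<open>auto dest: order_trans\<close>)

lemma conv_add: "conv c (\<lambda>i. f i + g i) m = conv c f m + conv c g m"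
  unfolding conv_def by (simp add: distrib_left sum.distrib)

lemma conv_scale: "conv c (\<lambda>i. s * f i) m = s * conv c f m"
  unfolding conv_def by (simp add: sum_distrib_left mult.left_commute)

lemma energy_scale: "energy w (\<lambda>m. s * f m) n = (cmod s)\<^sup>2 * energy w f n"
  unfolding energy_def by (simp add: sum_distrib_left norm_mult power_mult_distrib mult.assoc)

lemma energy_nonneg:
  assumes "\<And>m. w m \<ge> 0" shows "energy w f n \<ge> 0"
  unfolding energy_def by (intro sum_nonneg mult_nonneg_nonneg assms) auto

lemma energy_mono:
  assumes "\<And>m. w m \<ge> 0" "n \<le> n'" shows "energy w f n \<le> energy w f n'"
  unfolding energy_def
  by (intro sum_mono2) (use assms in \<open>auto dest: order_trans\<close>)

lemma cmod_add_sq: "(cmod (x + y))\<^sup>2 \<le> 2 * (cmod x)\<^sup>2 + 2 * (cmod y)\<^sup>2"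
proof -
  have "(cmod (x + y))\<^sup>2 \<le> (cmod x + cmod y)\<^sup>2"
    by (intro power_mono norm_triangle_ineq) auto
  also have "\<dots> \<le> 2 * (cmod x)\<^sup>2 + 2 * (cmod y)\<^sup>2"
    using sum_squares_bound[of "cmod x" "cmod y"] by (simp add: power2_sum)
  finally show ?thesis .
qed

lemma energy_add:
  assumes "\<And>m. w m \<ge> 0"
  shows "energy w (\<lambda>m. f m + g m) n \<le> 2 * energy w f n + 2 * energy w g n"
proof -
  have "energy w (\<lambda>m. f m + g m) n \<le> (\<Sum>m\<in>{..n}. (2 * (cmod (f m))\<^sup>2 + 2 * (cmod (g m))\<^sup>2) * w m)"
    unfolding energy_def by (intro sum_mono mult_right_mono cmod_add_sq assms)
  then show ?thesis unfolding energy_def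
    by (simp add: distrib_right sum.distrib sum_distrib_left mult.assoc)
qed

lemma cmod_sum_sq:
  "(cmod (sum f A))\<^sup>2 \<le> card A * (\<Sum>i\<in>A. (cmod (f i))\<^sup>2)"
proof -
  have "(cmod (sum f A))\<^sup>2 \<le> (\<Sum>i\<in>A. cmod (f i))\<^sup>2"
    by (intro power_mono norm_sum) auto
  also have "\<dots> \<le> (\<Sum>i\<in>A. (cmod (f i))\<^sup>2) * card A"
    by (rule sum_squared_le_sum_of_squares)
  finally show ?thesis by (simp add: mult.commute)
qed

text \<open>
  A linear map is bounded on a finite-dimensional space as soon as it is finite on the basis
  vectors. The gliding hump needs this in order to discard the part of a witness of unboundedness
  that lives in an already processed box.
\<close>
lemma conv_bounded_finite_support:
  assumes w: "\<And>m. w m > 0"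
    and B: "\<And>i. \<exists>B. \<forall>n. energy w (conv c (\<lambda>m. if m = i then 1 else 0)) n \<le> B"
  shows "\<exists>K\<ge>0. \<forall>f n. (\<forall>m. f m \<noteq> 0 \<longrightarrow> m \<le> N) \<longrightarrow> energy w (conv c f) n \<le> K * energy w f N"
proof -
  define e where "e i = (\<lambda>m. if m = i then 1 else 0 :: complex)" for i :: "nat \<times> nat"
  obtain B where B: "\<And>i n. energy w (conv c (e i)) n \<le> B i"
    using B unfolding e_def by metis
  have w0: "w m \<ge> 0" for m using w[of m] by simp
  have B0: "B i \<ge> 0" for i using B[of i 0] energy_nonneg[of w "conv c (e i)" 0] w0 by fastforce
  define S where "S = (\<Sum>i\<in>{..N}. B i / w i)"
  \<comment> \<open>\<open>S\<close> is a common bound for the images of the normalised basis vectors in the box.\<close>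
  have S: "B i / w i \<le> S" if "i \<le> N" for i
    unfolding S_def by (rule member_le_sum) (use that B0 w0 in auto)
  show ?thesis
  proof (intro exI[of _ "real (card {..N}) * S"] conjI allI impI)
    show "0 \<le> real (card {..N}) * S" unfolding S_def
      by (intro mult_nonneg_nonneg sum_nonneg divide_nonneg_nonneg B0 w0) auto
    fix f :: "nat \<times> nat \<Rightarrow> complex" and n assume f: "\<forall>m. f m \<noteq> 0 \<longrightarrow> m \<le> N"
    have T: "conv c f m = (\<Sum>i\<in>{..N}. f i * conv c (e i) m)" for m
    proof -
      have "(\<Sum>i\<in>{..N}. f i * conv c (e i) m) = (\<Sum>j\<in>{..m}. \<Sum>i\<in>{..N}. f i * (c (m - j) * e i j))"
        unfolding conv_def sum_distrib_left by (rule sum.swap)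
      also have "\<dots> = (\<Sum>j\<in>{..m}. c (m - j) * f j)"
      proof (rule sum.cong)
        fix j
        have "(\<Sum>i\<in>{..N}. f i * (c (m - j) * e i j)) = (\<Sum>i\<in>{..N}. if j = i then c (m - j) * f j else 0)"
          by (rule sum.cong) (auto simp: e_def)
        also have "\<dots> = c (m - j) * f j" using f[rule_format, of j] by auto
        finally show "(\<Sum>i\<in>{..N}. f i * (c (m - j) * e i j)) = c (m - j) * f j" .
      qed auto
      finally show ?thesis by (simp add: conv_def)
    qed
    have "energy w (conv c f) n \<le> (\<Sum>m\<in>{..n}. (real (card {..N}) * (\<Sum>i\<in>{..N}. (cmod (f i * conv c (e i) m))\<^sup>2)) * w m)"
      unfolding energy_def T by (intro sum_mono mult_right_mono cmod_sum_sq w0)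
    also have "\<dots> = real (card {..N}) * (\<Sum>i\<in>{..N}. (cmod (f i))\<^sup>2 * energy w (conv c (e i)) n)"
      unfolding energy_def sum_distrib_left sum_distrib_right
      by (subst sum.swap) (simp add: norm_mult power_mult_distrib mult_ac)
    also have "\<dots> \<le> real (card {..N}) * (\<Sum>i\<in>{..N}. S * ((cmod (f i))\<^sup>2 * w i))"
    proof (intro mult_left_mono sum_mono)
      fix i assume "i \<in> {..N}"
      then have "B i \<le> S * w i" using S[of i] w[of i] by (simp add: field_simps)
      with B[of i n] have "energy w (conv c (e i)) n \<le> S * w i" by linarith
      then have "(cmod (f i))\<^sup>2 * energy w (conv c (e i)) n \<le> (cmod (f i))\<^sup>2 * (S * w i)"
        by (rule mult_left_mono) auto
      then show "(cmod (f i))\<^sup>2 * energy w (conv c (e i)) n \<le> S * ((cmod (f i))\<^sup>2 * w i)"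
        by (simp add: mult_ac)
    qed auto
    also have "\<dots> = real (card {..N}) * S * energy w f N"
      by (simp add: energy_def sum_distrib_left mult.assoc)
    finally show "energy w (conv c f) n \<le> real (card {..N}) * S * energy w f N" .
  qed
qed

section \<open>Automatic boundedness\<close>

lemma energy_restrict:
  assumes "n \<le> n'" "\<forall>m. f m \<noteq> 0 \<longrightarrow> m \<le> n"
  shows "energy w f n' = energy w f n"
  unfolding energy_def
  by (rule sum.mono_neutral_right) (use assms in \<open>auto dest: order_trans\<close>)

text \<open>
  If the convolution operator is unbounded, it stays unbounded on families that vanish on a given box
  \<open>{..N}\<close>, since only a finite-dimensional part is lost. A hump \<open>g\<close> of prescribed small energy
  placed outside \<open>{..N}\<close> can therefore make the image of \<open>F + g\<close> as large as desired, whatever \<open>F\<close>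
  was built before.
\<close>
lemma gliding_hump_step:
  fixes w :: "nat \<times> nat \<Rightarrow> real" and r \<eta> :: real
  assumes w: "\<And>m. w m > 0"
    and B: "\<And>i. \<exists>B. \<forall>n. energy w (conv c (\<lambda>m. if m = i then 1 else 0)) n \<le> B"
    and unb: "\<And>K. \<not> bounded_conv w c K"
    and F: "\<forall>m. F m \<noteq> 0 \<longrightarrow> m \<le> N"
    and \<eta>: "\<eta> > 0"
  shows "\<exists>g N'. N \<le> N' \<and> p \<le> N' \<and> (\<forall>m. g m \<noteq> 0 \<longrightarrow> m \<le> N' \<and> \<not> m \<le> N) \<and>
           energy w g N' = \<eta> \<and> energy w (conv c (\<lambda>m. F m + g m)) N' \<ge> r"
proof -
  have w0: "w m \<ge> 0" for m using w[of m] by simp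
  note nn = energy_nonneg[of w, OF w0]
  obtain K where K: "K \<ge> 0"
    "\<And>f n. (\<forall>m. f m \<noteq> 0 \<longrightarrow> m \<le> N) \<Longrightarrow> energy w (conv c f) n \<le> K * energy w f N"
    using conv_bounded_finite_support[of w c N, OF w B] by blast
  define B where "B = K * energy w F N"
  have BF: "energy w (conv c F) n \<le> B" for n unfolding B_def by (rule K) (use F in auto)
  have B0: "B \<ge> 0" unfolding B_def using K(1) nn by simp
  \<comment> \<open>Half of the image energy of a hump of energy \<open>\<eta>\<close> must reach \<open>\<bar>r\<bar>\<close> plus the energy \<open>B\<close> already present.\<close>
  define L where "L = 2 * (\<bar>r\<bar> + B) / \<eta>"
  have L0: "L \<ge> 0" unfolding L_def using B0 \<eta> by simp
  obtain f n where f: "energy w (conv c f) n > 2 * (K + L) * energy w f n"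
    using unb[of "2 * (K + L)"] unfolding bounded_conv_def by (auto simp: not_le)
  define f1 where "f1 m = (if m \<le> n \<and> m \<le> N then f m else 0)" for m
  define f2 where "f2 m = (if m \<le> n \<and> \<not> m \<le> N then f m else 0)" for m
  have e1: "energy w f1 N \<le> energy w f n"
  proof -
    have "energy w f1 N \<le> energy w f1 (sup N n)" by (rule energy_mono) (auto simp: w0)
    also have "\<dots> = energy w f1 n" by (rule energy_restrict) (auto simp: f1_def)
    also have "\<dots> \<le> energy w f n" unfolding energy_def
      by (intro sum_mono mult_right_mono w0) (auto simp: f1_def)
    finally show ?thesis .
  qed
  have e2: "energy w f2 n \<le> energy w f n" unfolding energy_def
      by (intro sum_mono mult_right_mono w0) (auto simp: f2_def)
  have "energy w (conv c f) n = energy w (conv c (\<lambda>m. f1 m + f2 m)) n"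
    by (rule energy_conv_cong) (auto simp: f1_def f2_def)
  also have "\<dots> \<le> 2 * energy w (conv c f1) n + 2 * energy w (conv c f2) n"
    unfolding conv_add by (rule energy_add) (rule w0)
  also have "energy w (conv c f1) n \<le> K * energy w f1 N" by (rule K) (auto simp: f1_def)
  also have "K * energy w f1 N \<le> K * energy w f n" using e1 K(1) by (rule mult_left_mono)
  finally have Tf2: "energy w (conv c f2) n > L * energy w f n"
    using f by (simp add: algebra_simps)
  have Tf2': "energy w (conv c f2) n > L * energy w f2 n"
    using mult_left_mono[OF e2 L0] Tf2 by linarith
  have pos: "energy w f2 n > 0"
  proof (rule ccontr)
    assume "\<not> energy w f2 n > 0"
    then have "energy w f2 n = 0" using nn[of f2 n] by linarith
    then have "\<forall>m\<in>{..n}. (cmod (f2 m))\<^sup>2 * w m = 0"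
      unfolding energy_def by (subst (asm) sum_nonneg_eq_0_iff) (auto simp: w0)
    then have "f2 m = 0" if "m \<le> n" for m using that w[of m] by force
    then have "energy w (conv c f2) n = energy w (conv c (\<lambda>m. 0)) n"
      by (intro energy_conv_cong) auto
    also have "\<dots> = 0" by (simp add: conv_def energy_def)
    finally show False using Tf2' \<open>energy w f2 n = 0\<close> by simp
  qed
  define s where "s = complex_of_real (sqrt (\<eta> / energy w f2 n))"
  have s: "(cmod s)\<^sup>2 = \<eta> / energy w f2 n" unfolding s_def using \<eta> pos by simp
  define g where "g m = s * f2 m" for m
  define N' where "N' = sup (sup N p) n"
  have NN: "N \<le> N'" "p \<le> N'" "n \<le> N'" by (auto simp: N'_def intro: le_supI1 le_supI2)
  have supp: "\<forall>m. g m \<noteq> 0 \<longrightarrow> m \<le> N' \<and> \<not> m \<le> N"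
    using NN by (auto simp: g_def f2_def dest: order_trans split: if_splits)
  have eg: "energy w g N' = \<eta>"
  proof -
    have "energy w g N' = energy w g n"
      by (rule energy_restrict) (auto simp: g_def f2_def NN split: if_splits)
    also have "\<dots> = \<eta>" unfolding g_def energy_scale s using pos by simp
    finally show ?thesis .
  qed
  have "2 * (\<bar>r\<bar> + B) = L * \<eta>" unfolding L_def using \<eta> by simp
  also have "L * \<eta> \<le> energy w (conv c g) n"
  proof -
    have "L * \<eta> = (cmod s)\<^sup>2 * (L * energy w f2 n)" unfolding s using pos by simp
    also have "\<dots> \<le> (cmod s)\<^sup>2 * energy w (conv c f2) n" using Tf2' by (intro mult_left_mono) auto
    also have "\<dots> = energy w (conv c g) n" unfolding g_def conv_scale energy_scale ..
    finally show ?thesis .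
  qed
  also have "\<dots> \<le> energy w (conv c g) N'" by (rule energy_mono[OF w0 NN(3)])
  also have "\<dots> = energy w (\<lambda>m. conv c (\<lambda>m. F m + g m) m + (- 1) * conv c F m) N'"
    unfolding conv_add by simp
  also have "\<dots> \<le> 2 * energy w (conv c (\<lambda>m. F m + g m)) N' + 2 * energy w (\<lambda>m. (- 1) * conv c F m) N'"
    by (rule energy_add[OF w0])
  also have "energy w (\<lambda>m. (- 1) * conv c F m) N' \<le> B"
    unfolding energy_scale using BF by simp
  finally have "r \<le> energy w (conv c (\<lambda>m. F m + g m)) N'" by simp
  with NN supp eg show ?thesis by blast
qed

text \<open>
  The closed graph theorem for convolution operators, by a gliding hump. Were the operator unbounded,
  humps with energies \<open>1/2, 1/4, \<dots>\<close> supported in disjoint shells would add up to a family of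
  energy at most \<open>1\<close>. By triangularity, later humps do not change the image on earlier boxes, where
  the energy of the image already exceeds every given bound.
\<close>
lemma conv_uniformly_bounded:
  fixes w :: "nat \<times> nat \<Rightarrow> real"
  assumes w: "\<And>m. w m > 0"
    and bdd: "\<And>f C. (\<And>n. energy w f n \<le> C) \<Longrightarrow> \<exists>C'. \<forall>n. energy w (conv c f) n \<le> C'"
  shows "\<exists>K. bounded_conv w c K"
proof (rule ccontr)
  assume "\<nexists>K. bounded_conv w c K"
  then have unb: "\<not> bounded_conv w c K" for K by blast
  have w0: "w m \<ge> 0" for m using w[of m] by simp
  have B: "\<exists>B. \<forall>n. energy w (conv c (\<lambda>m. if m = i then 1 else 0)) n \<le> B" for i
  proof (rule bdd)
    fix n
    have "energy w (\<lambda>m. if m = i then 1 else 0) n = (\<Sum>m\<in>{..n}. if m = i then w i else 0)"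
      unfolding energy_def by (rule sum.cong) auto
    also have "\<dots> \<le> w i" using w0 by simp
    finally show "energy w (\<lambda>m. if m = i then 1 else 0) n \<le> w i" .
  qed
  \<comment> \<open>The slack \<open>(1/2) ^ k\<close> in the energy is exactly what the later humps use up.\<close>
  define P where "P k x \<longleftrightarrow> (case x of (F, N) \<Rightarrow> (\<forall>m. F m \<noteq> 0 \<longrightarrow> m \<le> N) \<and> (k, k) \<le> N \<and>
    energy w F N + (1/2) ^ k \<le> 1 \<and> energy w (conv c F) N \<ge> real k)"
    for k :: nat and x :: "(nat \<times> nat \<Rightarrow> complex) \<times> nat \<times> nat"
  define Q where "Q x y \<longleftrightarrow> snd x \<le> snd y \<and> (\<forall>m\<le>snd x. fst y m = fst x m)"
    for x y :: "(nat \<times> nat \<Rightarrow> complex) \<times> nat \<times> nat"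
  have "\<exists>X. \<forall>k. P k (X k) \<and> Q (X k) (X (Suc k))"
  proof (rule dependent_nat_choice)
    have "P 0 (\<lambda>m. 0, 0)"
      by (simp add: P_def energy_def conv_def zero_prod_def)
    then show "\<exists>x. P 0 x" ..
    fix x k assume "P k x"
    moreover obtain F N where x: "x = (F, N)" by (cases x)
    ultimately have F: "\<forall>m. F m \<noteq> 0 \<longrightarrow> m \<le> N" and eF: "energy w F N + (1/2) ^ k \<le> 1"
      by (auto simp: P_def)
    obtain g N' where g: "N \<le> N'" "(Suc k, Suc k) \<le> N'" "\<forall>m. g m \<noteq> 0 \<longrightarrow> m \<le> N' \<and> \<not> m \<le> N"
      "energy w g N' = (1/2) ^ Suc k" "energy w (conv c (\<lambda>m. F m + g m)) N' \<ge> real (Suc k)"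
      using gliding_hump_step[of w c F N "(1/2) ^ Suc k" "(Suc k, Suc k)" "real (Suc k)", OF w B unb F] 
      by auto
    have disj: "F m = 0 \<or> g m = 0" for m using F g(3) by blast
    have "energy w (\<lambda>m. F m + g m) N' = energy w F N' + energy w g N'"
      unfolding energy_def sum.distrib[symmetric]
    proof (rule sum.cong)
      fix m show "(cmod (F m + g m))\<^sup>2 * w m = (cmod (F m))\<^sup>2 * w m + (cmod (g m))\<^sup>2 * w m"
        using disj[of m] by auto
    qed auto
    also have "energy w F N' = energy w F N" by (rule energy_restrict[OF g(1) F])
    finally have e: "energy w (\<lambda>m. F m + g m) N' = energy w F N + (1/2) ^ Suc k" using g(4) by simp
    have "P (Suc k) (\<lambda>m. F m + g m, N')"
      unfolding P_def prod.case e
    proof (intro conjI)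
      show "\<forall>m. F m + g m \<noteq> 0 \<longrightarrow> m \<le> N'"
        using F g(1,3) by (metis add.right_neutral order_trans)
      show "energy w F N + (1/2) ^ Suc k + (1/2) ^ Suc k \<le> 1" using eF by simp
    qed (use g in auto)
    moreover have "Q x (\<lambda>m. F m + g m, N')" using g x by (auto simp: Q_def)
    ultimately show "\<exists>y. P (Suc k) y \<and> Q x y" by blast
  qed
  then obtain X where X: "\<And>k. P k (X k)" "\<And>k. Q (X k) (X (Suc k))" by blast
  define F N where "F k = fst (X k)" and "N k = snd (X k)" for k
  have PX: "(k, k) \<le> N k" "energy w (F k) (N k) \<le> 1" "energy w (conv c (F k)) (N k) \<ge> real k" for k
  proof -
    have *: "(\<forall>m. F k m \<noteq> 0 \<longrightarrow> m \<le> N k) \<and> (k, k) \<le> N k \<and>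
        energy w (F k) (N k) + (1/2) ^ k \<le> 1 \<and> real k \<le> energy w (conv c (F k)) (N k)"
      using X(1)[of k] unfolding P_def F_def N_def case_prod_beta .
    show "(k, k) \<le> N k" "energy w (conv c (F k)) (N k) \<ge> real k"
      by (rule *[THEN conjunct2, THEN conjunct1]) (rule *[THEN conjunct2, THEN conjunct2, THEN conjunct2])
    have "energy w (F k) (N k) + (1/2) ^ k \<le> 1"
      by (rule *[THEN conjunct2, THEN conjunct2, THEN conjunct1])
    moreover have "(0::real) \<le> (1/2) ^ k" by simp
    ultimately show "energy w (F k) (N k) \<le> 1" by linarith
  qed
  have QX: "N j \<le> N k \<and> (\<forall>m\<le>N j. F k m = F j m)" if "j \<le> k" for j k
    using that
  proof (induction k rule: dec_induct)
    case base
    show ?case by simp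
  next
    case (step k)
    have 1: "N k \<le> N (Suc k)" and 2: "\<forall>m\<le>N k. F (Suc k) m = F k m"
      using X(2)[of k] unfolding Q_def F_def N_def by blast+
    from step.IH have 3: "N j \<le> N k" and 4: "\<forall>m\<le>N j. F k m = F j m" by blast+
    have "F (Suc k) m = F j m" if "m \<le> N j" for m
    proof -
      have "m \<le> N k" using that 3 by (rule order_trans)
      then have "F (Suc k) m = F k m" using 2 by blast
      also have "\<dots> = F j m" using 4 that by blast
      finally show ?thesis .
    qed
    with order_trans[OF 3 1] show ?case by blast
  qed
  \<comment> \<open>Stage \<open>k\<close> fixes all values on \<open>{..(k, k)}\<close>, a box that contains \<open>m\<close> for \<open>k = fst m + snd m\<close>.\<close>
  define f where "f m = F (fst m + snd m) m" for m
  have fF: "f m = F k m" if "m \<le> N k" for m k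
  proof -
    define j where "j = fst m + snd m"
    have "m \<le> (j, j)" by (simp add: j_def less_eq_prod_def)
    also have "\<dots> \<le> N j" by (rule PX)
    finally have "m \<le> N j" .
    have "F j m = F k m"
    proof (cases "j \<le> k")
      case True
      then have "\<forall>m\<le>N j. F k m = F j m" using QX by blast
      with \<open>m \<le> N j\<close> show ?thesis by (simp del: split_paired_All)
    next
      case False
      then have "\<forall>m\<le>N k. F j m = F k m" using QX[of k j] by simp
      with that show ?thesis by blast
    qed
    then show ?thesis by (simp add: f_def j_def)
  qed
  have "energy w f n \<le> 1" for n
  proof -
    define k where "k = fst n + snd n"
    have "n \<le> (k, k)" by (simp add: k_def less_eq_prod_def)
    also have "\<dots> \<le> N k" by (rule PX)
    finally have "energy w f n \<le> energy w f (N k)" by (intro energy_mono w0)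
    also have "\<dots> = energy w (F k) (N k)" by (rule energy_cong) (rule fF)
    finally show ?thesis using PX(2)[of k] by simp
  qed
  then obtain C' where C': "\<And>n. energy w (conv c f) n \<le> C'" using bdd[of f 1] by blast
  obtain k :: nat where k: "real k > C'" using reals_Archimedean2 by blast
  have "real k \<le> energy w (conv c (F k)) (N k)" by (rule PX)
  also have "\<dots> = energy w (conv c f) (N k)" by (rule energy_conv_cong) (simp add: fF)
  also have "\<dots> \<le> C'" by (rule C')
  finally show False using k by simp
qed

section \<open>Passing to other weights\<close>

lemma conv_shift:
  "conv c (\<lambda>m. if p \<le> m then f (m - p) else 0) (m + p) = conv c f m"
proof -
  have "conv c (\<lambda>m. if p \<le> m then f (m - p) else 0) (m + p) =
      (\<Sum>i\<in>{..m + p}. if p \<le> i then c (m + p - i) * f (i - p) else 0)"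
    unfolding conv_def by (rule sum.cong) auto
  also have "\<dots> = (\<Sum>i\<in>{p..m + p}. c (m + p - i) * f (i - p))"
    by (rule sum.mono_neutral_cong_right) auto
  also have "\<dots> = (\<Sum>i\<in>{..m}. c (m - i) * f i)"
  proof (rule sum.reindex_bij_witness[of _ "\<lambda>i. i + p" "\<lambda>i. i - p"])
    fix i assume i: "i \<in> {p..m + p}"
    then show "i - p + p = i" by simp
    show "i - p \<in> {..m}" using i by (auto simp: less_eq_prod_def)
    show "c (m - (i - p)) * f (i - p) = c (m + p - i) * f (i - p)"
      using i pair_add_diff(2)[of m p "i - p"] by simp
  qed (auto simp: less_eq_prod_def)
  finally show ?thesis by (simp add: conv_def)
qed

text \<open>
  Convolution commutes with translation of the coefficients (multiplication by a monomial), so the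
  bound is inherited by every translate of the weight, with the same constant.
\<close>
lemma bounded_conv_shift:
  assumes w: "\<And>m. w m \<ge> 0" and K: "bounded_conv w c K"
  shows "bounded_conv (\<lambda>m. w (m + p)) c K"
  unfolding bounded_conv_def
proof (intro allI)
  fix f :: "nat \<times> nat \<Rightarrow> complex" and n
  define g where "g = (\<lambda>m. if p \<le> m then f (m - p) else 0)"
  have *: "energy (\<lambda>m. w (m + p)) h n = (\<Sum>m\<in>{p..n + p}. (cmod (h (m - p)))\<^sup>2 * w m)" for h
    unfolding energy_def
    by (rule sum.reindex_bij_witness[of _ "\<lambda>i. i - p" "\<lambda>i. i + p"]) (auto simp: less_eq_prod_def)
  have "energy (\<lambda>m. w (m + p)) (conv c f) n = (\<Sum>m\<in>{p..n + p}. (cmod (conv c g m))\<^sup>2 * w m)"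
    unfolding *
  proof (rule sum.cong)
    fix m assume "m \<in> {p..n + p}"
    then show "(cmod (conv c f (m - p)))\<^sup>2 * w m = (cmod (conv c g m))\<^sup>2 * w m"
      using conv_shift[of c p f "m - p"] by (simp add: g_def)
  qed auto
  also have "\<dots> \<le> energy w (conv c g) (n + p)"
    unfolding energy_def by (rule sum_mono2) (auto simp: w)
  also have "\<dots> \<le> K * energy w g (n + p)" by (rule bounded_convD[OF K])
  also have "energy w g (n + p) = energy (\<lambda>m. w (m + p)) f n"
    unfolding * unfolding energy_def by (rule sum.mono_neutral_cong_right) (auto simp: g_def)
  finally show "energy (\<lambda>m. w (m + p)) (conv c f) n \<le> K * energy (\<lambda>m. w (m + p)) f n" .
qed

text \<open>
  Each inequality involves finitely many indices only, hence survives pointwise limits of suitably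
  normalised weights.
\<close>
lemma bounded_conv_limit:
  assumes b: "\<And>j::nat. bounded_conv (v j) c K"
    and lim: "\<And>m. (\<lambda>j. v j m / s j) \<longlonglongrightarrow> u m" and s: "\<And>j. s j > 0"
  shows "bounded_conv u c K"
  unfolding bounded_conv_def
proof (intro allI)
  fix f :: "nat \<times> nat \<Rightarrow> complex" and n
  have *: "(\<lambda>j. energy (v j) h n / s j) \<longlonglongrightarrow> energy u h n" for h
    unfolding energy_def sum_divide_distrib
    by (intro tendsto_sum) (use tendsto_mult[OF tendsto_const lim] in \<open>simp add: mult.assoc\<close>)
  show "energy u (conv c f) n \<le> K * energy u f n"
  proof (rule LIMSEQ_le[OF * tendsto_mult[OF tendsto_const *]])
    have "energy (v j) (conv c f) n / s j \<le> K * (energy (v j) f n / s j)" for j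
      using divide_right_mono[OF bounded_convD[OF b[of j], of f n] less_imp_le[OF s[of j]]] by simp
    then show "\<exists>N. \<forall>j\<ge>N. energy (v j) (conv c f) n / s j \<le> K * (energy (v j) f n / s j)" by blast
  qed
qed

text \<open>
  The elementary form of real interpolation between the weights \<open>w\<close> and \<open>t\<close>: the indices with
  \<open>w \<le> t\<close> are estimated with \<open>w\<close>, the others with the constant weight \<open>t\<close>. Cutting off the weight at a box is free of
  charge by triangularity.
\<close>
lemma bounded_conv_box_min:
  assumes K: "bounded_conv w c K" "bounded_conv (\<lambda>_. 1) c K" and w: "\<And>m. w m \<ge> 0" and t: "t \<ge> 0"
  shows "bounded_conv (\<lambda>m. if m \<le> q then min (w m) t else 0) c (2 * K)"
  unfolding bounded_conv_def
proof (intro allI)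
  fix f :: "nat \<times> nat \<Rightarrow> complex" and n
  define v where "v m = min (w m) t" for m
  have box: "energy (\<lambda>m. if m \<le> q then min (w m) t else 0) h n = energy v h (inf n q)" for h
    unfolding energy_def by (rule sum.mono_neutral_cong_right) (auto simp: v_def)
  define r where "r = inf n q"
  define f0 where "f0 m = (if w m \<le> t then f m else 0)" for m
  define f1 where "f1 m = (if w m \<le> t then 0 else f m)" for m
  have "energy v (conv c f) r = energy v (\<lambda>m. conv c f0 m + conv c f1 m) r"
    unfolding conv_add[symmetric] by (intro energy_conv_cong) (auto simp: f0_def f1_def)
  also have "\<dots> \<le> 2 * energy v (conv c f0) r + 2 * energy v (conv c f1) r"
    by (rule energy_add) (auto simp: v_def w t)
  also have "energy v (conv c f0) r \<le> energy w (conv c f0) r"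
    unfolding energy_def by (intro sum_mono mult_left_mono) (auto simp: v_def)
  also have "\<dots> \<le> K * energy w f0 r" by (rule bounded_convD[OF K(1)])
  also have "energy v (conv c f1) r \<le> t * energy (\<lambda>_. 1) (conv c f1) r"
    unfolding energy_def sum_distrib_left
    by (intro sum_mono) (auto simp: v_def mult.commute intro!: mult_right_mono)
  also have "\<dots> \<le> t * (K * energy (\<lambda>_. 1) f1 r)"
    by (intro mult_left_mono bounded_convD[OF K(2)] t)
  finally have "energy v (conv c f) r \<le> 2 * K * (energy w f0 r + t * energy (\<lambda>_. 1) f1 r)"
    by (simp add: algebra_simps)
  also have "energy w f0 r + t * energy (\<lambda>_. 1) f1 r = energy v f r"
    unfolding energy_def sum_distrib_left sum.distrib[symmetric]
    by (rule sum.cong) (auto simp: f0_def f1_def v_def)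
  finally show "energy (\<lambda>m. if m \<le> q then min (w m) t else 0) (conv c f) n \<le>
      2 * K * energy (\<lambda>m. if m \<le> q then min (w m) t else 0) f n"
    unfolding box r_def .
qed

lemma bounded_conv_sum:
  assumes "\<And>j. j \<in> J \<Longrightarrow> bounded_conv (v j) c K" "\<And>j. j \<in> J \<Longrightarrow> b j \<ge> 0"
  shows "bounded_conv (\<lambda>m. \<Sum>j\<in>J. b j * v j m) c K"
  unfolding bounded_conv_def
proof (intro allI)
  fix f :: "nat \<times> nat \<Rightarrow> complex" and n
  have *: "energy (\<lambda>m. \<Sum>j\<in>J. b j * v j m) h n = (\<Sum>j\<in>J. b j * energy (v j) h n)" for h
    unfolding energy_def sum_distrib_left
    by (subst sum.swap) (simp add: mult_ac)
  have "(\<Sum>j\<in>J. b j * energy (v j) (conv c f) n) \<le> (\<Sum>j\<in>J. b j * (K * energy (v j) f n))"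
    by (intro sum_mono mult_left_mono bounded_convD assms)
  then show "energy (\<lambda>m. \<Sum>j\<in>J. b j * v j m) (conv c f) n \<le> K * energy (\<lambda>m. \<Sum>j\<in>J. b j * v j m) f n"
    unfolding * by (simp add: sum_distrib_left mult_ac)
qed

section \<open>Power weights\<close>

definition D_weight :: "real \<times> real \<Rightarrow> nat \<times> nat \<Rightarrow> real" where
  "D_weight \<alpha> m = (real (fst m) + 1) powr fst \<alpha> * (real (snd m) + 1) powr snd \<alpha>"

lemma D_weight_pos: "D_weight \<alpha> m > 0"
  by (simp add: D_weight_def)

lemma D_weight_nonneg: "D_weight \<alpha> m \<ge> 0"
  by (simp add: D_weight_def)

lemma powr_shift_ratio:
  fixes a :: real
  shows "(\<lambda>j. (real k + real j + 1) powr a / (real j + 1) powr a) \<longlonglongrightarrow> 1"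
  proof -
    have "(\<lambda>j. 1 + real k * inverse (real (Suc j))) \<longlonglongrightarrow> 1 + real k * 0"
      by (intro tendsto_intros LIMSEQ_inverse_real_of_nat)
    then have "(\<lambda>j. (1 + real k * inverse (real (Suc j))) powr a) \<longlonglongrightarrow> (1 + real k * 0) powr a"
      by (rule tendsto_powr) auto
    moreover have "(real k + real j + 1) powr a / (real j + 1) powr a = (1 + real k * inverse (real (Suc j))) powr a" for j
      by (subst powr_divide[symmetric]) (auto simp: field_simps)
    ultimately show ?thesis by simp
  qed

text \<open>
  Translating by \<open>(j, j)\<close> and dividing by the weight at \<open>(j, j)\<close> flattens a power weight: the quotients
  tend to \<open>1\<close>. In function-theoretic terms, a multiplier of a space with power weights is a multiplier of
  the Hardy space of the bidisc, that is, bounded.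
\<close>
lemma bounded_conv_unweighted:
  assumes "bounded_conv (D_weight \<alpha>) c K"
  shows "bounded_conv (\<lambda>_. 1) c K"
proof (rule bounded_conv_limit[where v = "\<lambda>j m. D_weight \<alpha> (m + (j, j))" and s = "\<lambda>j. D_weight \<alpha> (j, j)"])
  fix j show "bounded_conv (\<lambda>m. D_weight \<alpha> (m + (j, j))) c K"
    by (rule bounded_conv_shift) (use assms D_weight_nonneg in auto)
  fix m :: "nat \<times> nat"
  show "(\<lambda>j. D_weight \<alpha> (m + (j, j)) / D_weight \<alpha> (j, j)) \<longlonglongrightarrow> 1"
    using tendsto_mult[OF powr_shift_ratio[of "fst m" "fst \<alpha>"] powr_shift_ratio[of "snd m" "snd \<alpha>"]]
    by (simp add: D_weight_def)
qed (rule D_weight_pos)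

section \<open>Interpolation between power weights\<close>

lemma dyadic_ceiling:
  "\<exists>a\<le>k. real k + 1 \<le> 2 ^ a \<and> (2::real) ^ a \<le> 2 * (real k + 1)"
proof -
  define a where "a = (LEAST a. real k + 1 \<le> 2 ^ a)"
  have "real (Suc k) \<le> real (2 ^ k)" by (subst of_nat_le_iff) (simp add: Suc_leI)
  then have k: "real k + 1 \<le> 2 ^ k" by simp
  have 1: "real k + 1 \<le> 2 ^ a" unfolding a_def by (rule LeastI) (rule k)
  have 2: "a \<le> k" unfolding a_def by (rule Least_le) (rule k)
  have 3: "(2::real) ^ a \<le> 2 * (real k + 1)"
  proof (cases a)
    case (Suc b)
    then have "\<not> real k + 1 \<le> 2 ^ b" using not_less_Least[of b "\<lambda>a. real k + 1 \<le> 2 ^ a"] by (simp add: a_def)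
    then show ?thesis using Suc by simp
  qed simp
  from 1 2 3 show ?thesis by blast
qed

lemma powr_comparable:
  assumes "x \<le> y" "y \<le> 2 * x" "x > (0::real)"
  shows "2 powr (- \<bar>a\<bar>) * x powr a \<le> y powr a"
proof -
  have "(x / y) powr a \<le> 2 powr \<bar>a\<bar>"
  proof (cases "a \<ge> 0")
    case True
    have "(x / y) powr a \<le> 2 powr a" using True assms by (intro powr_mono2) (auto simp: field_simps)
    with True show ?thesis by simp
  next
    case False
    have "(x / y) powr a = (y / x) powr (- a)" using assms by (simp add: powr_minus powr_divide field_simps)
    also have "\<dots> \<le> 2 powr (- a)" using False assms by (intro powr_mono2) (auto simp: field_simps)
    finally show ?thesis using False by simp
  qed
  then show ?thesis using assms by (simp add: powr_divide powr_minus field_simps)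
qed

text \<open>
  A geometric series is comparable to its first term, here at the first power of two above \<open>x\<close>.
\<close>
lemma dyadic_tail_le:
  fixes d x :: real
  assumes "d > 0" "x > 0"
  shows "(\<Sum>i\<le>n. if x \<le> 2 ^ i then (2 ^ i) powr (- d) else 0) \<le> x powr (- d) / (1 - 2 powr (- d))"
proof (cases "\<exists>i\<le>n. x \<le> 2 ^ i")
  case False
  have "0 \<le> x powr (- d) / (1 - 2 powr (- d))"
    using assms by (intro divide_nonneg_nonneg) (auto simp: powr_le_one_le powr_minus field_simps ge_one_powr_ge_zero)
  moreover have "(\<Sum>i\<le>n. if x \<le> 2 ^ i then (2 ^ i) powr (- d) else 0) = 0"
    by (rule sum.neutral) (use False in auto)
  ultimately show ?thesis by simp
next
  case True
  define a where "a = (LEAST a. x \<le> 2 ^ a)"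
  have a: "x \<le> 2 ^ a" unfolding a_def using True by (metis LeastI)
  have le: "a \<le> i" if "x \<le> 2 ^ i" for i unfolding a_def using that by (rule Least_le)
  define \<rho> where "\<rho> = (2::real) powr (- d)"
  have \<rho>: "0 < \<rho>" "\<rho> < 1" using assms by (auto simp: \<rho>_def powr_less_one)
  have pw: "(2 ^ i) powr (- d) = \<rho> ^ i" for i
    by (simp add: \<rho>_def powr_powr powr_realpow[symmetric] mult.commute)
  have "(\<Sum>i\<le>n. if x \<le> 2 ^ i then (2 ^ i) powr (- d) else 0) \<le> (\<Sum>i\<in>{a..<a + Suc n}. \<rho> ^ i)"
    unfolding pw
  proof (rule order_trans[OF _ sum_mono2])
    show "(\<Sum>i\<le>n. if x \<le> 2 ^ i then \<rho> ^ i else 0) \<le> sum ((^) \<rho>) ({..n} \<inter> {a..})"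
    proof -
      have "(\<Sum>i\<le>n. if x \<le> 2 ^ i then \<rho> ^ i else 0) \<le> (\<Sum>i\<le>n. if i \<in> {a..} then \<rho> ^ i else 0)"
        by (rule sum_mono) (use le \<rho> in auto)
      also have "\<dots> = sum ((^) \<rho>) ({..n} \<inter> {a..})" by (subst sum.inter_restrict) auto
      finally show ?thesis .
    qed
  qed (use \<rho> in auto)
  also have "\<dots> = \<rho> ^ a * (\<Sum>i<Suc n. \<rho> ^ i)"
    unfolding sum_distrib_left power_add[symmetric]
    by (rule sum.reindex_bij_witness[of _ "\<lambda>i. a + i" "\<lambda>i. i - a"]) auto
  also have "\<dots> \<le> \<rho> ^ a * (1 / (1 - \<rho>))"
  proof (rule mult_left_mono)
    have "(\<Sum>i<Suc n. \<rho> ^ i) = (1 - \<rho> ^ Suc n) / (1 - \<rho>)"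
      using \<rho> by (subst sum_gp_strict) auto
    also have "\<dots> \<le> 1 / (1 - \<rho>)" using \<rho> by (intro divide_right_mono) auto
    finally show "(\<Sum>i<Suc n. \<rho> ^ i) \<le> 1 / (1 - \<rho>)" .
  qed (use \<rho> in auto)
  also have "\<dots> = (2 ^ a) powr (- d) / (1 - \<rho>)" by (simp add: pw)
  also have "\<dots> \<le> x powr (- d) / (1 - \<rho>)"
    using a assms \<rho> by (intro divide_right_mono powr_mono2') auto
  finally show ?thesis by (simp add: \<rho>_def)
qed

text \<open>
  The weight of \<open>\<beta>\<close> is comparable to a superposition of weights to which the box-and-minimum estimate
  applies. With \<open>\<delta> = \<alpha> - \<beta>\<close> and \<open>w\<close> the weight of \<open>\<alpha>\<close>, consider the sum over all \<open>i, j\<close> of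
  \<open>2 powr (- i \<delta>\<^sub>1 - j \<delta>\<^sub>2)\<close> times the minimum of \<open>w\<close> and \<open>2 powr (i \<alpha>\<^sub>1 + j \<alpha>\<^sub>2)\<close>, cut off to the box
  \<open>k < 2 ^ i, l < 2 ^ j\<close>. The single term given by the least powers of two above \<open>k\<close> and \<open>l\<close> already has the
  size of the weight of \<open>\<beta>\<close> at \<open>(k, l)\<close>. Conversely, bounding the minimum by \<open>w\<close> leaves two geometric tails; they
  converge, with the right size, precisely because \<open>\<delta>\<^sub>1, \<delta>\<^sub>2 > 0\<close>. On the box \<open>{..n}\<close> the terms with
  \<open>(i, j) \<le> n\<close> suffice, so only finite sums occur.
\<close>
lemma conv_interpolation:
  assumes dom: "dominates \<alpha> \<beta>" and K: "K \<ge> 0" "bounded_conv (D_weight \<alpha>) c K"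
  shows "\<exists>K'. bounded_conv (D_weight \<beta>) c K'"
proof -
  define d1 d2 where "d1 = fst \<alpha> - fst \<beta>" and "d2 = snd \<alpha> - snd \<beta>"
  have d: "d1 > 0" "d2 > 0" using dom by (auto simp: dominates_def d1_def d2_def)
  define t where "t = (\<lambda>(i::nat, j::nat). (2 ^ i) powr fst \<alpha> * (2 ^ j) powr snd \<alpha> :: real)"
  define b where "b = (\<lambda>(i::nat, j::nat). (2 ^ i) powr (- d1) * (2 ^ j) powr (- d2) :: real)"
  define q where "q = (\<lambda>(i::nat, j::nat). (2 ^ i - 1, 2 ^ j - 1) :: nat \<times> nat)"
  define v where "v x m = (if m \<le> q x then min (D_weight \<alpha> m) (t x) else 0)" for x m
  have v: "bounded_conv (v x) c (2 * K)" for x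
    unfolding v_def
    by (rule bounded_conv_box_min[OF K(2) bounded_conv_unweighted[OF K(2)]])
       (auto simp: D_weight_nonneg t_def split: prod.split)
  have b0: "b x \<ge> 0" for x by (auto simp: b_def split: prod.split)
  have q: "m \<le> q (i, j) \<longleftrightarrow> real (fst m) + 1 \<le> 2 ^ i \<and> real (snd m) + 1 \<le> 2 ^ j" for m i j
  proof -
    have "k \<le> 2 ^ e - 1 \<longleftrightarrow> real k + 1 \<le> 2 ^ e" for k e :: nat
    proof -
      have "k \<le> 2 ^ e - 1 \<longleftrightarrow> Suc k \<le> 2 ^ e"
        using zero_less_power[of "2::nat" e] by linarith
      also have "\<dots> \<longleftrightarrow> real (Suc k) \<le> real (2 ^ e)" by (rule of_nat_le_iff[symmetric])
      finally show ?thesis by (simp add: add.commute)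
    qed
    then show ?thesis by (simp add: q_def less_eq_prod_def)
  qed
  have W\<beta>: "D_weight \<beta> m = D_weight \<alpha> m * ((real (fst m) + 1) powr (- d1) * (real (snd m) + 1) powr (- d2))" for m
    unfolding D_weight_def d1_def d2_def by (simp add: powr_diff)
  define s where "s = 2 powr (- \<bar>fst \<alpha>\<bar>) * 2 powr (- \<bar>snd \<alpha>\<bar>)"
  define A where "A = s * (2 powr (- d1) * 2 powr (- d2))"
  have s: "0 < s" "s \<le> 1"
    using powr_mono[of "- \<bar>fst \<alpha>\<bar>" 0 "2::real"] powr_mono[of "- \<bar>snd \<alpha>\<bar>" 0 "2::real"]
    by (simp_all add: s_def mult_le_one)
  have A0: "A > 0" using s by (simp add: A_def)
  define B where "B = 1 / ((1 - 2 powr (- d1)) * (1 - 2 powr (- d2)))"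
  have lower: "A * D_weight \<beta> m \<le> (\<Sum>x\<in>{..fst n} \<times> {..snd n}. b x * v x m)" if mn: "m \<le> n" for m n
  proof -
    obtain i where i: "i \<le> fst m" "real (fst m) + 1 \<le> 2 ^ i" "2 ^ i \<le> 2 * (real (fst m) + 1)"
      using dyadic_ceiling by blast
    obtain j where j: "j \<le> snd m" "real (snd m) + 1 \<le> 2 ^ j" "2 ^ j \<le> 2 * (real (snd m) + 1)"
      using dyadic_ceiling by blast
    have "s * D_weight \<alpha> m \<le> t (i, j)"
      using mult_mono[OF powr_comparable[OF i(2,3), of "fst \<alpha>"] powr_comparable[OF j(2,3), of "snd \<alpha>"]]
      by (simp add: s_def t_def D_weight_def mult_ac)
    moreover have "s * D_weight \<alpha> m \<le> D_weight \<alpha> m"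
      using s D_weight_nonneg[of \<alpha> m] by (intro mult_left_le_one_le) auto
    ultimately have 1: "s * D_weight \<alpha> m \<le> v (i, j) m" using i j by (simp add: v_def q)
    have 2: "2 powr (- d1) * 2 powr (- d2) * ((real (fst m) + 1) powr (- d1) * (real (snd m) + 1) powr (- d2)) \<le> b (i, j)"
      using mult_mono[OF powr_comparable[OF i(2,3), of "- d1"] powr_comparable[OF j(2,3), of "- d2"]] d
      by (simp add: b_def mult_ac)
    have "A * D_weight \<beta> m \<le> b (i, j) * v (i, j) m"
      using mult_mono[OF 2 1] s D_weight_nonneg[of \<alpha> m] b0 by (simp add: A_def W\<beta> mult_ac)
    also have "\<dots> \<le> (\<Sum>x\<in>{..fst n} \<times> {..snd n}. b x * v x m)"
    proof (rule member_le_sum)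
      show "(i, j) \<in> {..fst n} \<times> {..snd n}" using i(1) j(1) mn by (auto simp: less_eq_prod_def)
      show "0 \<le> b x * v x m" for x
        using b0[of x] D_weight_nonneg[of \<alpha> m] by (auto simp: v_def t_def split: prod.split)
    qed auto
    finally show ?thesis .
  qed
  have upper: "(\<Sum>x\<in>{..fst n} \<times> {..snd n}. b x * v x m) \<le> B * D_weight \<beta> m" for m n
  proof -
    \<comment> \<open>One-variable factors of the cut-off coefficients.\<close>
    define g where "g y e i = (if y \<le> 2 ^ i then (2 ^ i) powr (- e) else 0 :: real)" for y e :: real and i :: nat
    have "(\<Sum>x\<in>{..fst n} \<times> {..snd n}. b x * v x m) \<le>
        (\<Sum>(i, j)\<in>{..fst n} \<times> {..snd n}. D_weight \<alpha> m * (g (real (fst m) + 1) d1 i * g (real (snd m) + 1) d2 j))"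
    proof (rule sum_mono, clarify)
      fix i j
      show "b (i, j) * v (i, j) m \<le> D_weight \<alpha> m * (g (real (fst m) + 1) d1 i * g (real (snd m) + 1) d2 j)"
        using b0[of "(i, j)"] D_weight_nonneg[of \<alpha> m]
        by (auto simp: v_def q g_def b_def mult.commute[of "D_weight \<alpha> m"] intro!: mult_left_mono)
    qed
    also have "\<dots> = D_weight \<alpha> m * ((\<Sum>i\<le>fst n. g (real (fst m) + 1) d1 i) * (\<Sum>j\<le>snd n. g (real (snd m) + 1) d2 j))"
      unfolding sum_product sum.cartesian_product by (simp add: sum_distrib_left case_prod_beta)
    also have "\<dots> \<le> D_weight \<alpha> m * ((real (fst m) + 1) powr (- d1) / (1 - 2 powr (- d1)) *
        ((real (snd m) + 1) powr (- d2) / (1 - 2 powr (- d2))))"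
      unfolding g_def
      by (intro mult_left_mono mult_mono dyadic_tail_le d D_weight_nonneg)
         (use d in \<open>auto intro!: sum_nonneg divide_nonneg_nonneg simp: powr_less_one less_imp_le\<close>)
    finally show ?thesis by (simp add: B_def W\<beta>)
  qed
  have "energy (D_weight \<beta>) (conv c f) n \<le> (2 * K * B / A) * energy (D_weight \<beta>) f n" for f n
  proof -
    define u where "u m = (\<Sum>x\<in>{..fst n} \<times> {..snd n}. b x * v x m)" for m
    have "A * energy (D_weight \<beta>) (conv c f) n \<le> energy u (conv c f) n"
      unfolding energy_def sum_distrib_left
    proof (rule sum_mono)
      fix m assume "m \<in> {..n}"
      then show "A * ((cmod (conv c f m))\<^sup>2 * D_weight \<beta> m) \<le> (cmod (conv c f m))\<^sup>2 * u m"
        using mult_left_mono[OF lower[of m n], of "(cmod (conv c f m))\<^sup>2"] by (simp add: u_def mult_ac)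
    qed
    also have "\<dots> \<le> 2 * K * energy u f n"
      unfolding u_def by (intro bounded_convD bounded_conv_sum v b0)
    also have "\<dots> \<le> 2 * K * (B * energy (D_weight \<beta>) f n)"
    proof (rule mult_left_mono)
      show "energy u f n \<le> B * energy (D_weight \<beta>) f n"
        unfolding energy_def sum_distrib_left
      proof (rule sum_mono)
        fix m
        show "(cmod (f m))\<^sup>2 * u m \<le> B * ((cmod (f m))\<^sup>2 * D_weight \<beta> m)"
          using mult_left_mono[OF upper[where m = m and n = n], of "(cmod (f m))\<^sup>2"] by (simp add: u_def mult_ac)
      qed
    qed (use K in simp)
    finally show ?thesis using A0 by (simp add: pos_le_divide_eq mult_ac)
  qed
  then show ?thesis unfolding bounded_conv_def by blast
qed

section \<open>Power series on the bidisc\<close>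

definition monom2 :: "complex \<times> complex \<Rightarrow> nat \<times> nat \<Rightarrow> complex" where
  "monom2 p m = fst p ^ fst m * snd p ^ snd m"

definition series_on_bidisc :: "(nat \<times> nat \<Rightarrow> complex) \<Rightarrow> (complex \<times> complex \<Rightarrow> complex) \<Rightarrow> bool" where
  "series_on_bidisc a f \<longleftrightarrow> (\<forall>p\<in>bidisc. ((\<lambda>m. a m * monom2 p m) has_sum f p) UNIV)"

lemma monom2_add: "monom2 p (m + n) = monom2 p m * monom2 p n"
  by (simp add: monom2_def power_add mult_ac)

lemma summable_iff_bounded_energy:
  assumes w: "\<And>m. w m \<ge> 0"
  shows "(\<lambda>m. (cmod (a m))\<^sup>2 * w m) summable_on UNIV \<longleftrightarrow> (\<exists>C. \<forall>n. energy w a n \<le> C)"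
proof
  assume s: "(\<lambda>m. (cmod (a m))\<^sup>2 * w m) summable_on UNIV"
  show "\<exists>C. \<forall>n. energy w a n \<le> C"
    unfolding energy_def
    by (rule exI[of _ "\<Sum>\<^sub>\<infinity>m. (cmod (a m))\<^sup>2 * w m"], intro allI finite_sum_le_infsum[OF s]) (auto simp: w)
next
  assume "\<exists>C. \<forall>n. energy w a n \<le> C"
  then obtain C where C: "\<And>n. energy w a n \<le> C" by blast
  show "(\<lambda>m. (cmod (a m))\<^sup>2 * w m) summable_on UNIV"
  proof (rule nonneg_bounded_partial_sums_imp_summable_on)
    show "\<forall>\<^sub>F X in finite_subsets_at_top UNIV. (\<Sum>m\<in>X. (cmod (a m))\<^sup>2 * w m) \<le> C"
    proof (rule eventually_finite_subsets_at_top_weakI)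
      fix X :: "(nat \<times> nat) set" assume "finite X"
      define n where "n = (\<Sum>m\<in>X. m)"
      have "m \<le> n" if "m \<in> X" for m
        unfolding n_def using sum.remove[OF \<open>finite X\<close> that, of "\<lambda>m. m"] by simp
      then have "(\<Sum>m\<in>X. (cmod (a m))\<^sup>2 * w m) \<le> energy w a n"
        unfolding energy_def by (intro sum_mono2) (auto simp: w)
      also have "\<dots> \<le> C" by (rule C)
      finally show "(\<Sum>m\<in>X. (cmod (a m))\<^sup>2 * w m) \<le> C" .
    qed
  qed (auto simp: w)
qed

lemma D_space_iff:
  "f \<in> D_space \<alpha> \<longleftrightarrow> (\<exists>a. (\<exists>C. \<forall>n. energy (D_weight \<alpha>) a n \<le> C) \<and> series_on_bidisc a f)"
  unfolding summable_iff_bounded_energy[OF D_weight_nonneg, symmetric] D_space_def series_on_bidisc_def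
  by (simp add: D_weight_def monom2_def case_prod_unfold mult.assoc)

lemma has_sum_times:
  fixes x :: "'a \<Rightarrow> 'c :: {real_normed_field, banach}"
  assumes "(\<lambda>i. norm (x i)) summable_on A" "(\<lambda>j. norm (y j)) summable_on B" "(x has_sum X) A" "(y has_sum Y) B"
  shows "((\<lambda>(i, j). x i * y j) has_sum (X * Y)) (A \<times> B)"
proof (rule has_sum_SigmaI[where g = "\<lambda>i. x i * Y"])
  show "((\<lambda>b. case (i, b) of (i, j) \<Rightarrow> x i * y j) has_sum x i * Y) B" for i
    using has_sum_cmult_right[OF assms(4), of "x i"] by simp
  show "((\<lambda>i. x i * Y) has_sum X * Y) A"
    by (rule has_sum_cmult_left[OF assms(3)])
  have "(\<lambda>ij. norm (case ij of (i, j) \<Rightarrow> x i * y j)) summable_on (A \<times> B)"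
  proof (rule summable_on_SigmaI[where g = "\<lambda>i. norm (x i) * (\<Sum>\<^sub>\<infinity>j\<in>B. norm (y j))"])
    show "((\<lambda>j. norm (case (i, j) of (i, j) \<Rightarrow> x i * y j)) has_sum norm (x i) * (\<Sum>\<^sub>\<infinity>j\<in>B. norm (y j))) B" for i
      using has_sum_cmult_right[OF has_sum_infsum[OF assms(2)], of "norm (x i)"] by (simp add: norm_mult)
    show "(\<lambda>i. norm (x i) * (\<Sum>\<^sub>\<infinity>j\<in>B. norm (y j))) summable_on A"
      using has_sum_cmult_left[OF has_sum_infsum[OF assms(1)]] by (rule has_sum_imp_summable)
  qed auto
  then show "(\<lambda>(i, j). x i * y j) summable_on A \<times> B" by (rule abs_summable_summable)
qed

text \<open>
  The Cauchy product: both series converge absolutely, so the product can be summed over all pairs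
  \<open>(i, j)\<close> and regrouped along \<open>m = i + j\<close>.
\<close>
lemma series_on_bidisc_mult:
  assumes "series_on_bidisc c \<phi>" "series_on_bidisc a f"
  shows "series_on_bidisc (conv c a) (\<lambda>p. \<phi> p * f p)"
  unfolding series_on_bidisc_def
proof
  fix p assume p: "p \<in> bidisc"
  have c: "((\<lambda>m. c m * monom2 p m) has_sum \<phi> p) UNIV" and a: "((\<lambda>m. a m * monom2 p m) has_sum f p) UNIV"
    using assms p by (auto simp: series_on_bidisc_def)
  have "((\<lambda>(i, j). (c i * monom2 p i) * (a j * monom2 p j)) has_sum \<phi> p * f p) (UNIV \<times> UNIV)"
    using c a has_sum_imp_summable[OF c] has_sum_imp_summable[OF a]
    unfolding summable_on_iff_abs_summable_on_complex by (intro has_sum_times)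
  also have "?this \<longleftrightarrow> ((\<lambda>(m, j). c (m - j) * a j * monom2 p m) has_sum \<phi> p * f p) (Sigma UNIV (\<lambda>m. {..m}))"
  proof (rule has_sum_reindex_bij_witness[of _ "\<lambda>(m, j). (m - j, j)" "\<lambda>(i, j). (i + j, j)"])
    show "(case case x of (i, j) \<Rightarrow> (i + j, j) of (m, j) \<Rightarrow> c (m - j) * a j * monom2 p m) =
        (case x of (i, j) \<Rightarrow> (c i * monom2 p i) * (a j * monom2 p j))" for x
      by (cases x) (simp add: monom2_add mult_ac)
  qed (auto simp del: split_paired_All)
  finally have S: "((\<lambda>(m, j). c (m - j) * a j * monom2 p m) has_sum \<phi> p * f p) (Sigma UNIV (\<lambda>m. {..m}))" .
  show "((\<lambda>m. conv c a m * monom2 p m) has_sum \<phi> p * f p) UNIV"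
  proof (rule has_sum_SigmaD[OF S])
    show "((\<lambda>j. case (m, j) of (m, j) \<Rightarrow> c (m - j) * a j * monom2 p m) has_sum conv c a m * monom2 p m) {..m}" for m
      by (rule has_sum_finiteI) (auto simp: conv_def sum_distrib_right)
  qed
qed

text \<open>
  After the vanishing lower terms are divided out, the value at \<open>z \<rightarrow> 0\<close> is the next coefficient.
\<close>
lemma power_series_zero_coeffs:
  fixes g :: "nat \<Rightarrow> complex"
  assumes "\<And>z. cmod z < 1 \<Longrightarrow> (\<lambda>n. g n * z ^ n) sums 0"
  shows "g n = 0"
proof (induction n rule: less_induct)
  case (less n)
  have "(\<lambda>k. g (k + n) * z ^ k) sums 0" if z: "z \<noteq> 0" "cmod z < 1" for z
  proof -
    have "(\<lambda>k. g (k + n) * z ^ (k + n)) sums (0 - (\<Sum>i<n. g i * z ^ i))"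
      using assms[OF z(2)] by (subst sums_iff_shift) simp
    then have "(\<lambda>k. g (k + n) * z ^ (k + n) * inverse (z ^ n)) sums (0 * inverse (z ^ n))"
      using less by (intro sums_mult2) simp
    then show ?thesis using z by (simp add: power_add field_simps)
  qed
  then have "((\<lambda>_. 0) \<longlongrightarrow> g (0 + n)) (at (0::complex))"
    by (intro powser_limit_0_strong[of 1]) auto
  then show ?case by (simp add: tendsto_const_iff)
qed

text \<open>
  For fixed \<open>w\<close> the double series is a power series in \<open>z\<close> whose coefficients are power series in \<open>w\<close>,
  so the one-variable identity principle applies twice.
\<close>
lemma series_on_bidisc_unique:
  assumes "series_on_bidisc a f" "series_on_bidisc b f"
  shows "a = b"
proof -
  define d where "d m = a m - b m" for m
  have S: "((\<lambda>(k, l). d (k, l) * (z ^ k * w ^ l)) has_sum 0) (UNIV \<times> UNIV)" if "cmod z < 1" "cmod w < 1" for z w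
  proof -
    have "(z, w) \<in> bidisc" using that by (simp add: bidisc_def)
    then have "((\<lambda>m. a m * monom2 (z, w) m + - (b m * monom2 (z, w) m)) has_sum (f (z, w) + - f (z, w))) UNIV"
      using assms by (intro has_sum_add) (auto simp: series_on_bidisc_def has_sum_uminus)
    moreover have "(\<lambda>m. a m * monom2 (z, w) m + - (b m * monom2 (z, w) m)) = (\<lambda>(k, l). d (k, l) * (z ^ k * w ^ l))"
      by (simp add: fun_eq_iff d_def monom2_def left_diff_distrib)
    ultimately show ?thesis by simp
  qed
  define s where "s w k = (\<Sum>\<^sub>\<infinity>l. d (k, l) * w ^ l)" for w k
  have inner: "(\<lambda>l. d (k, l) * w ^ l) summable_on UNIV" if w: "cmod w < 1" for w k
  proof -
    have "(\<lambda>(k, l). d (k, l) * ((1/2) ^ k * w ^ l)) summable_on UNIV \<times> UNIV"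
      using S[of "1/2" w] w by (intro has_sum_imp_summable) (auto simp: norm_divide)
    then have "(\<lambda>l. d (k, l) * ((1/2) ^ k * w ^ l)) summable_on UNIV"
      by (rule summable_on_SigmaD1) simp
    then have "(\<lambda>l. 2 ^ k * (d (k, l) * ((1/2) ^ k * w ^ l))) summable_on UNIV"
      by (rule summable_on_cmult_right)
    then show ?thesis by (simp add: power_divide)
  qed
  have "s w k = 0" if w: "cmod w < 1" for w k
  proof (rule power_series_zero_coeffs)
    fix z :: complex assume z: "cmod z < 1"
    have "((\<lambda>k. s w k * z ^ k) has_sum 0) UNIV"
    proof (rule has_sum_SigmaD[OF S[OF z w]])
      show "((\<lambda>l. case (k, l) of (k, l) \<Rightarrow> d (k, l) * (z ^ k * w ^ l)) has_sum s w k * z ^ k) UNIV" for k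
        using has_sum_cmult_left[OF has_sum_infsum[OF inner[OF w, of k]], of "z ^ k"]
        by (simp add: s_def mult_ac)
    qed
    then show "(\<lambda>k. s w k * z ^ k) sums 0" by (rule has_sum_imp_sums)
  qed
  then have "d (k, l) = 0" for k l
  proof (intro power_series_zero_coeffs[of "\<lambda>l. d (k, l)"])
    fix w :: complex assume w: "cmod w < 1" and "\<And>w k. cmod w < 1 \<Longrightarrow> s w k = 0"
    then show "(\<lambda>l. d (k, l) * w ^ l) sums 0"
      using has_sum_imp_sums[OF has_sum_infsum[OF inner[OF w, of k]]] by (simp add: s_def)
  qed
  then show ?thesis by (auto simp: d_def fun_eq_iff)
qed

lemma summable_powr_times_power:
  fixes x s :: real
  assumes "0 \<le> x" "x < 1"
  shows "(\<lambda>k. (real k + 1) powr s * x ^ k) summable_on UNIV"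
proof -
  define c where "c = (1 + x) / 2"
  have c: "c < 1" "x < c" using assms by (auto simp: c_def)
  have "(\<lambda>k. x * ((real 1 + real k + 1) powr s / (real k + 1) powr s)) \<longlonglongrightarrow> x * 1"
    by (intro tendsto_mult tendsto_const powr_shift_ratio)
  then have "\<forall>\<^sub>F k in sequentially. x * ((real 1 + real k + 1) powr s / (real k + 1) powr s) < c"
    by (rule order_tendstoD) (use c in simp)
  then obtain N where N: "\<And>k. k \<ge> N \<Longrightarrow> x * ((real 1 + real k + 1) powr s / (real k + 1) powr s) < c"
    by (auto simp: eventually_sequentially)
  have "summable (\<lambda>k. (real k + 1) powr s * x ^ k)"
  proof (rule summable_ratio_test[OF c(1), of N])
    fix k assume "N \<le> k"
    then have "x * (real 1 + real k + 1) powr s \<le> c * (real k + 1) powr s"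
      using N[of k] by (simp add: field_simps)
    then have "x ^ k * (x * (real 1 + real k + 1) powr s) \<le> x ^ k * (c * (real k + 1) powr s)"
      using assms by (intro mult_left_mono) auto
    then show "norm ((real (Suc k) + 1) powr s * x ^ Suc k) \<le> c * norm ((real k + 1) powr s * x ^ k)"
      using assms by (simp add: mult_ac add_ac)
  qed
  then show ?thesis using assms
    by (simp add: summable_on_UNIV_nonneg_real_iff)
qed

text \<open>
  A family of bounded weighted energy is always the expansion of a function: on the bidisc the
  series is dominated, through \<open>x y \<le> x\<^sup>2 W + y\<^sup>2 / W\<close>, by the energy and by the sum of
  \<open>\<bar>z\<bar>\<^bsup>2k\<^esup> \<bar>w\<bar>\<^bsup>2l\<^esup> / W\<close>, a product of two convergent series.
\<close>
lemma bounded_energy_summable_on_bidisc: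
  assumes a: "\<And>n. energy (D_weight \<alpha>) a n \<le> C" and p: "p \<in> bidisc"
  shows "(\<lambda>m. a m * monom2 p m) summable_on UNIV"
proof -
  define h where "h x s k = (real k + 1) powr s * (x\<^sup>2) ^ k" for x s :: real and k :: nat
  have h: "h (cmod z) s summable_on UNIV" if "cmod z < 1" for z s
    unfolding h_def by (rule summable_powr_times_power) (use that in \<open>auto simp: power_less_one_iff abs_square_less_1\<close>)
  have "(\<lambda>m. (cmod (a m))\<^sup>2 * D_weight \<alpha> m) summable_on UNIV"
    unfolding summable_iff_bounded_energy[OF D_weight_nonneg] using a by blast
  moreover have "(\<lambda>(k, l). h (cmod (fst p)) (- fst \<alpha>) k * h (cmod (snd p)) (- snd \<alpha>) l) summable_on UNIV \<times> UNIV"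
  proof (rule has_sum_imp_summable, rule has_sum_times)
    have "cmod (fst p) < 1" "cmod (snd p) < 1" using p by (auto simp: bidisc_def)
    note hp = h[OF this(1), of "- fst \<alpha>"] h[OF this(2), of "- snd \<alpha>"]
    show "(\<lambda>k. norm (h (cmod (fst p)) (- fst \<alpha>) k)) summable_on UNIV"
      "(\<lambda>l. norm (h (cmod (snd p)) (- snd \<alpha>) l)) summable_on UNIV"
      by (rule hp(1)[THEN summable_on_iff_abs_summable_on_real[THEN iffD1]], rule hp(2)[THEN summable_on_iff_abs_summable_on_real[THEN iffD1]])
    show "(h (cmod (fst p)) (- fst \<alpha>) has_sum infsum (h (cmod (fst p)) (- fst \<alpha>)) UNIV) UNIV"
      "(h (cmod (snd p)) (- snd \<alpha>) has_sum infsum (h (cmod (snd p)) (- snd \<alpha>)) UNIV) UNIV"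
      by (rule has_sum_infsum[OF hp(1)], rule has_sum_infsum[OF hp(2)])
  qed
  ultimately have "(\<lambda>m. (cmod (a m))\<^sup>2 * D_weight \<alpha> m +
      (case m of (k, l) \<Rightarrow> h (cmod (fst p)) (- fst \<alpha>) k * h (cmod (snd p)) (- snd \<alpha>) l)) summable_on UNIV"
    by (intro summable_on_add) auto
  then have "(\<lambda>m. norm (a m * monom2 p m)) summable_on UNIV"
  proof (rule summable_on_comparison_test)
    fix m :: "nat \<times> nat"
    define W M where "W = D_weight \<alpha> m" and "M = cmod (monom2 p m)"
    have W: "W > 0" unfolding W_def by (rule D_weight_pos)
    have "(case m of (k, l) \<Rightarrow> h (cmod (fst p)) (- fst \<alpha>) k * h (cmod (snd p)) (- snd \<alpha>) l) = M\<^sup>2 / W"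
      unfolding h_def M_def W_def D_weight_def monom2_def
      by (cases m) (simp add: powr_minus norm_mult norm_power power_mult_distrib power_mult[symmetric] mult.commute[of 2] divide_simps)
    moreover have "cmod (a m) * M \<le> (cmod (a m))\<^sup>2 * W + M\<^sup>2 / W"
    proof -
      \<comment> \<open>The inequality of the means, balanced so that the first square carries the weight and the second its inverse.\<close>
      have "2 * (cmod (a m) * sqrt W) * (M / sqrt W) \<le> (cmod (a m) * sqrt W)\<^sup>2 + (M / sqrt W)\<^sup>2"
        by (rule sum_squares_bound)
      then have "2 * (cmod (a m) * M) \<le> (cmod (a m))\<^sup>2 * W + M\<^sup>2 / W"
        using W by (simp add: power_mult_distrib power_divide)
      moreover have "0 \<le> cmod (a m) * M" by (simp add: M_def)
      ultimately show ?thesis by linarith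
    qed
    ultimately show "norm (a m * monom2 p m) \<le> (cmod (a m))\<^sup>2 * D_weight \<alpha> m +
      (case m of (k, l) \<Rightarrow> h (cmod (fst p)) (- fst \<alpha>) k * h (cmod (snd p)) (- snd \<alpha>) l)"
      by (simp add: W_def M_def norm_mult)
  qed auto
  then show ?thesis by (rule abs_summable_summable)
qed

section \<open>Inclusion of the multiplier spaces\<close>

lemma multipliersD: "\<phi> \<in> multipliers \<alpha> \<Longrightarrow> f \<in> D_space \<alpha> \<Longrightarrow> (\<lambda>p. \<phi> p * f p) \<in> D_space \<alpha>"
  by (simp add: multipliers_def)

text \<open>
  The translation from functions to coefficients. A multiplier is itself a power series because it is
  its own product with the constant \<open>1\<close>; by uniqueness of coefficients it acts by convolution, and the
  uniform bound comes for free from the gliding hump.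
\<close>
lemma multiplier_coeffs:
  assumes \<phi>: "\<phi> \<in> multipliers \<alpha>"
  obtains c K where "series_on_bidisc c \<phi>" "K \<ge> 0" "bounded_conv (D_weight \<alpha>) c K"
proof -
  define e where "e m = (if m = 0 then 1 else 0 :: complex)" for m :: "nat \<times> nat"
  have "(\<lambda>_. 1) \<in> D_space \<alpha>"
    unfolding D_space_iff
  proof (intro exI[of _ e] conjI exI[of _ 1] allI)
    fix n :: "nat \<times> nat"
    have "energy (D_weight \<alpha>) e n = (\<Sum>m\<in>{..n}. if m = 0 then 1 else 0)"
      unfolding energy_def e_def by (intro sum.cong) (auto simp: D_weight_def)
    also have "\<dots> \<le> 1" by simp
    finally show "energy (D_weight \<alpha>) e n \<le> 1" .
    show "series_on_bidisc e (\<lambda>_. 1)"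
      unfolding series_on_bidisc_def
    proof
      fix p
      show "((\<lambda>m. e m * monom2 p m) has_sum 1) UNIV"
        by (rule has_sum_finite_neutralI[of "{0}"]) (auto simp: e_def monom2_def)
    qed
  qed
  from multipliersD[OF \<phi> this] have "\<phi> \<in> D_space \<alpha>" by simp
  then obtain c where c: "series_on_bidisc c \<phi>" unfolding D_space_iff by blast
  have "\<exists>K. bounded_conv (D_weight \<alpha>) c K"
  proof (rule conv_uniformly_bounded[OF D_weight_pos])
    fix a :: "nat \<times> nat \<Rightarrow> complex" and C assume a: "\<And>n. energy (D_weight \<alpha>) a n \<le> C"
    define f where "f p = (\<Sum>\<^sub>\<infinity>m. a m * monom2 p m)" for p
    have f: "series_on_bidisc a f"
      unfolding series_on_bidisc_def f_def
      using has_sum_infsum[OF bounded_energy_summable_on_bidisc[OF a]] by blast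
    then have "f \<in> D_space \<alpha>" using a unfolding D_space_iff by blast
    with \<phi> have "(\<lambda>p. \<phi> p * f p) \<in> D_space \<alpha>" by (rule multipliersD)
    then obtain d where d: "\<exists>C. \<forall>n. energy (D_weight \<alpha>) d n \<le> C" "series_on_bidisc d (\<lambda>p. \<phi> p * f p)"
      unfolding D_space_iff by blast
    have "d = conv c a" by (rule series_on_bidisc_unique[OF d(2) series_on_bidisc_mult[OF c f]])
    with d(1) show "\<exists>C'. \<forall>n. energy (D_weight \<alpha>) (conv c a) n \<le> C'" by simp
  qed
  then obtain K where K: "bounded_conv (D_weight \<alpha>) c K" by blast
  have "bounded_conv (D_weight \<alpha>) c \<bar>K\<bar>"
    unfolding bounded_conv_def
  proof (intro allI)
    fix g n
    have "K * energy (D_weight \<alpha>) g n \<le> \<bar>K\<bar> * energy (D_weight \<alpha>) g n"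
      by (intro mult_right_mono energy_nonneg D_weight_nonneg) simp
    then show "energy (D_weight \<alpha>) (conv c g) n \<le> \<bar>K\<bar> * energy (D_weight \<alpha>) g n"
      using bounded_convD[OF K, of g n] by linarith
  qed
  with c show ?thesis using that[of c "\<bar>K\<bar>"] by simp
qed

theorem theorem3p12:
  fixes \<alpha> \<beta> :: "real \<times> real"
  assumes "dominates \<alpha> \<beta>"
  shows "multipliers \<alpha> \<subseteq> multipliers \<beta>"
proof
  fix \<phi> assume "\<phi> \<in> multipliers \<alpha>"
  then obtain c K where c: "series_on_bidisc c \<phi>" and K: "K \<ge> 0" "bounded_conv (D_weight \<alpha>) c K"
    by (rule multiplier_coeffs)
  obtain K' where K': "bounded_conv (D_weight \<beta>) c K'"
    using conv_interpolation[OF assms K] by blast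
  show "\<phi> \<in> multipliers \<beta>"
    unfolding multipliers_def
  proof safe
    fix f assume "f \<in> D_space \<beta>"
    then obtain a C where a: "\<And>n. energy (D_weight \<beta>) a n \<le> C" "series_on_bidisc a f"
      unfolding D_space_iff by blast
    have "energy (D_weight \<beta>) (conv c a) n \<le> \<bar>K'\<bar> * C" for n
    proof -
      have "energy (D_weight \<beta>) (conv c a) n \<le> K' * energy (D_weight \<beta>) a n"
        by (rule bounded_convD[OF K'])
      also have "\<dots> \<le> \<bar>K'\<bar> * energy (D_weight \<beta>) a n"
        by (intro mult_right_mono energy_nonneg D_weight_nonneg) simp
      also have "\<dots> \<le> \<bar>K'\<bar> * C" by (intro mult_left_mono a) simp
      finally show ?thesis .
    qed
    then show "(\<lambda>p. \<phi> p * f p) \<in> D_space \<beta>"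
      unfolding D_space_iff using series_on_bidisc_mult[OF c a(2)] by blast
  qed
qed

end
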